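(* For each integer $s \ge 2$, there are at most finitely many $s$-Cullen numbers $C_{n,s} = n s^n + 1$ ($n$ a positive integer) that are repunits.
   Context: For integers $s \ge 2$ and $n \ge 1$, the $s$-Cullen numbers are the numbers $C_{n,s} = n s^n + 1$. A positive integer $m$ is called a repunit if there exist integers $b \ge 2$ and $q \ge 3$ such that $m = \frac{b^q-1}{b-1} = b^{q-1} + b^{q-2} + \cdots + b + 1$ (i.e. in some base $b\ge 2$ all digits of $m$ are $1$ and $m$ has at least $3$ digits). *)

theory Defs
  imports Complex_Main
begin

definition cullen :: "nat \<Rightarrow> nat \<Rightarrow> nat" where
  "cullen n s = n * s ^ n + 1"

definition repunit :: "nat \<Rightarrow> bool" where
  "repunit m \<longleftrightarrow> (\<exists>b q :: nat. b \<ge> 2 \<and> q \<ge> 3 \<and> m = (\<Sum>i<q. b ^ i))"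

lemma repunit_iff_quotient:
  "repunit m \<longleftrightarrow>
    (\<exists>b q :: nat. b \<ge> 2 \<and> q \<ge> 3 \<and> real m = (real b ^ q - 1) / (real b - 1))"
proof -
  have "m = (\<Sum>i<q. b ^ i) \<longleftrightarrow> real m = (real b ^ q - 1) / (real b - 1)"
    if "b \<ge> 2" for b q :: nat
  proof -
    have "real (\<Sum>i<q. b ^ i) = (real b ^ q - 1) / (real b - 1)"
      using that by (simp add: geometric_sum)
    then show ?thesis
      by (metis of_nat_eq_iff)
  qed
  then show ?thesis
    unfolding repunit_def by blast
qed

end

theory Submission
  imports Defs "HOL-Number_Theory.Number_Theory" "HOL-Computational_Algebra.Nth_Powers"
begin

text \<open>
  Write a repunit with \<open>j + 2\<close> digits as \<open>1 + b M\<close> with \<open>M = 1 + b + \<dots> + b\<^sup>j\<close>, \<open>j \<ge> 1\<close>. If it is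
  \<open>n s\<^sup>n + 1\<close>, then \<open>n s\<^sup>n = b M\<close>, and \<open>b\<close> and \<open>M\<close> are coprime. Hence \<open>s\<close> factors as \<open>s\<^sub>1 s\<^sub>2\<close> with
  \<open>b = n\<^sub>1 s\<^sub>1\<^sup>n\<close>, \<open>M = n\<^sub>2 s\<^sub>2\<^sup>n\<close> and \<open>n = n\<^sub>1 n\<^sub>2\<close> (lemma \<open>power_dvd_coprime_mult\<close>): up to
  factors of polynomial size, \<open>b\<close> and \<open>M\<close> are \<open>n\<close>-th powers of integers. For large \<open>n\<close> both
  shapes of this factorization are impossible.

  If \<open>s\<^sub>1 \<ge> 2\<close>, size decides. Since \<open>b\<^sup>j \<le> M < 2 b\<^sup>j\<close>, the quotient of \<open>(s\<^sub>1\<^sup>j)\<^sup>n\<close> and \<open>s\<^sub>2\<^sup>n\<close> is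
  polynomially bounded in \<open>n\<close> from both sides. But \<open>s\<^sub>1\<close> and \<open>s\<^sub>2\<close> are coprime, so
  \<open>s\<^sub>1\<^sup>j \<noteq> s\<^sub>2\<close>, and the quotient is exponentially large or small.

  If \<open>s\<^sub>1 = 1\<close>, then \<open>b \<le> n\<close> and \<open>s\<^sup>n\<close> divides \<open>M\<close>, so every prime \<open>p\<close> dividing \<open>s\<close> satisfies
  \<open>p\<^sup>n dvd b\<^bsup>j+1\<^esup> - 1\<close>. By lifting the exponent (lemma \<open>prime_power_dvd_power_minus_one\<close>),
  \<open>p\<^sup>n\<close> then divides \<open>(b\<^bsup>\<phi>(p\<^sup>2)\<^esup> - 1) (j + 1)\<close>. This positive number is polynomially bounded in
  \<open>n\<close>, because \<open>j\<close> is at most linear in \<open>n\<close>, so it is less than \<open>2\<^sup>n\<close>.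
\<close>

section \<open>Powers dividing a product of coprime numbers\<close>

lemma power_dvd_coprime_mult:
  fixes s b c n :: nat
  assumes "s > 0" "n > 0" "coprime b c" "s ^ n dvd b * c"
  obtains s1 s2 where "s = s1 * s2" "s1 ^ n dvd b" "s2 ^ n dvd c"
proof -
  from division_decomp[OF assms(4)] obtain u v
    where uv: "s ^ n = u * v" "u dvd b" "v dvd c" by blast
  have "coprime u v" using uv assms(3) by (meson coprime_divisors)
  moreover have "is_nth_power n (u * v)" using uv(1) by (metis is_nth_power_nth_power)
  moreover have "u > 0" "v > 0" using uv(1) assms(1) by (metis mult_eq_0_iff neq0_conv power_not_zero)+
  ultimately have "is_nth_power n u" "is_nth_power n v"
    using is_nth_power_mult_coprime_natD by blast+
  then obtain s1 s2 where s12: "u = s1 ^ n" "v = s2 ^ n"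
    by (auto elim!: is_nth_powerE)
  have "s ^ n = (s1 * s2) ^ n" using uv(1) s12 by (simp add: power_mult_distrib)
  hence "s = s1 * s2" using assms(2) by (metis power_eq_imp_eq_base zero_le)
  thus ?thesis using that uv s12 by blast
qed

section \<open>Lifting the exponent\<close>

text \<open>
  Each factor \<open>p\<close> of \<open>k\<close> contributes \<open>(x\<^sup>p - 1) / (x - 1) = 1 + x + \<dots> + x\<^bsup>p-1\<^esup> \<equiv> p\<close> modulo \<open>p\<^sup>2\<close>,
  which is divisible by \<open>p\<close> exactly once; the part of \<open>k\<close> prime to \<open>p\<close> contributes nothing.
  Working modulo \<open>p\<^sup>2\<close> treats \<open>p = 2\<close> like the odd primes.
\<close>

lemma prime_power_dvd_power_minus_one:
  fixes p c :: int
  assumes p: "prime p" and c: "[c = 1] (mod p ^ 2)" and "p ^ n dvd c ^ k - 1"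
  shows "p ^ n dvd (c - 1) * int k"
  using assms(3)
proof (induction k arbitrary: n rule: less_induct)
  case (less k)
  have geo: "x ^ m - 1 = (x - 1) * (\<Sum>i<m. x ^ i)" for x :: int and m
    by (rule power_diff_1_eq)
  have sum_cong: "[(\<Sum>i<m. x ^ i) = int m] (mod q)" if "[x = 1] (mod q)" for x q :: int and m
  proof -
    have "[(\<Sum>i<m. x ^ i) = (\<Sum>i<m. 1)] (mod q)"
      using cong_pow[OF that] by (intro cong_sum) auto
    thus ?thesis by simp
  qed
  consider "k = 0" | "n = 0" | "k > 0" "\<not> p dvd int k" | "k > 0" "n > 0" "p dvd int k" by blast
  thus ?case
  proof cases
    case 3
    have "[c = 1] (mod p)" using c by (rule cong_modulus_mult[of _ _ p p, folded power2_eq_square])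
    hence "\<not> p dvd (\<Sum>i<k. c ^ i)" using sum_cong 3 cong_dvd_iff by blast
    hence "coprime (p ^ n) (\<Sum>i<k. c ^ i)"
      using p by (intro coprime_power_left_iff[THEN iffD2] disjI1 prime_imp_coprime)
    hence "p ^ n dvd c - 1" using less.prems geo coprime_dvd_mult_left_iff by metis
    thus ?thesis by simp
  next
    case 4
    have pn: "p ^ n = p * p ^ (n - 1)" using 4 by (simp add: power_eq_if)
    define P where "P = nat p"
    have P: "p = int P" using prime_gt_0_int[OF p] by (simp add: P_def)
    have "P dvd k" using 4 P by (metis int_dvd_int_iff)
    then obtain j where j: "k = P * j" by (elim dvdE)
    have "P > 1" using prime_gt_1_int[OF p] P by simp
    hence "j < k" using 4 j by simp
    define S where "S = (\<Sum>i<P. (c ^ j) ^ i)"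
    have fact: "c ^ k - 1 = (c ^ j - 1) * S"
      unfolding S_def using geo[of "c ^ j" P] by (simp add: j power_mult[symmetric] mult.commute)
    have "[c ^ j = 1] (mod p ^ 2)" using cong_pow[OF c, of j] by simp
    hence S: "[S = p] (mod p ^ 2)" unfolding S_def P by (rule sum_cong)
    then obtain t where "S - p = p ^ 2 * t" by (metis cong_iff_dvd_diff dvdE)
    hence S': "S = p * (1 + p * t)" by (simp add: algebra_simps power2_eq_square)
    have cop: "coprime (p ^ (n - 1)) (1 + p * t)"
      by (intro coprime_power_left_iff[THEN iffD2] disjI1)
         (metis coprime_1_right gcd_add_mult coprime_iff_gcd_eq_1 mult.commute add.commute)
    have "p * p ^ (n - 1) dvd p * ((c ^ j - 1) * (1 + p * t))"
      using less.prems fact S' pn by (simp add: mult_ac)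
    hence "p ^ (n - 1) dvd (c ^ j - 1) * (1 + p * t)" using \<open>P > 1\<close> P by simp
    hence "p ^ (n - 1) dvd c ^ j - 1" using cop coprime_dvd_mult_left_iff by blast
    \<comment> \<open>The single factor \<open>p\<close> split off from \<open>S\<close> is paid for by \<open>k = p j\<close>.\<close>
    from less.IH[OF \<open>j < k\<close> this] have "p * p ^ (n - 1) dvd p * ((c - 1) * int j)"
      by (intro mult_dvd_mono) auto
    thus ?thesis unfolding pn using j P by (simp add: mult_ac)
  qed auto
qed

section \<open>Geometric sums\<close>

lemma coprime_geometric_sum:
  fixes b :: nat
  shows "coprime b (\<Sum>i\<le>j. b ^ i)"
proof -
  have "(\<Sum>i\<le>j. b ^ i) = 1 + b * (\<Sum>i<j. b ^ i)"
    by (simp add: lessThan_Suc_atMost[symmetric] sum.lessThan_Suc_shift sum_distrib_left del: sum.lessThan_Suc)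
  thus ?thesis
    by (metis coprime_1_right gcd_add_mult coprime_iff_gcd_eq_1 mult.commute add.commute)
qed

lemma power_le_geometric_sum:
  fixes b :: nat
  shows "b ^ j \<le> (\<Sum>i\<le>j. b ^ i)"
  by (rule member_le_sum) auto

lemma geometric_sum_less:
  fixes b :: nat
  assumes "b \<ge> 2"
  shows "(\<Sum>i\<le>j. b ^ i) < 2 * b ^ j"
proof (induction j)
  case (Suc j)
  have "2 * b ^ j \<le> b ^ Suc j" using assms by simp
  moreover have "(\<Sum>i\<le>Suc j. b ^ i) = (\<Sum>i\<le>j. b ^ i) + b ^ Suc j" by simp
  ultimately show ?case using Suc.IH by linarith
qed simp

section \<open>The two shapes of the factorization\<close>

text \<open>
  Here \<open>s\<close> is prime to \<open>b\<close>. For a prime \<open>p\<close> dividing \<open>s\<close>, lifting the exponent applies to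
  \<open>b\<^bsup>\<phi>(p\<^sup>2)\<^esup>\<close>, which is \<open>1\<close> modulo \<open>p\<^sup>2\<close> by Euler's theorem. As \<open>\<phi>(p\<^sup>2) \<le> s\<^sup>2\<close>, this power is
  still at most \<open>n\<close> to the fixed exponent \<open>s\<^sup>2\<close>.
\<close>

lemma polynomial_base_impossible:
  fixes n s b j :: nat
  assumes s: "s \<ge> 2" and n: "n \<ge> 1" and b: "b \<ge> 2" and bn: "b \<le> n"
    and eq: "n * s ^ n = b * (\<Sum>i\<le>j. b ^ i)" and dv: "s ^ n dvd (\<Sum>i\<le>j. b ^ i)"
    and dom: "(s + 2) * n ^ (s ^ 2 + 1) < 2 ^ n"
  shows False
proof -
  define M where "M = (\<Sum>i\<le>j. b ^ i)"
  obtain p where p: "prime p" "p dvd s" using s prime_factor_nat[of s] by auto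
  have "p ^ n dvd M" using dv p(2) unfolding M_def by (meson dvd_trans dvd_power_same)
  have "p dvd M" using \<open>p ^ n dvd M\<close> n by (metis dvd_power dvd_trans less_le_trans zero_less_one)
  hence "coprime b p" using coprime_geometric_sum[of b j] unfolding M_def
    by (meson coprime_divisors dvd_refl)
  define t where "t = totient (p ^ 2)"
  have "t \<le> p ^ 2" unfolding t_def by (rule totient_le)
  also have "p ^ 2 \<le> s ^ 2" using dvd_imp_le[OF p(2)] s by (intro power_mono) auto
  finally have t: "t \<le> s ^ 2" .
  have "t > 0" unfolding t_def using p by (simp add: prime_gt_0_nat)
  have "[b ^ t = 1] (mod p ^ 2)"
    unfolding t_def using \<open>coprime b p\<close> by (intro euler_theorem) auto
  hence c: "[(int b) ^ t = 1] (mod (int p) ^ 2)"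
    by (metis cong_int_iff of_nat_1 of_nat_power)
  have "(int b) ^ (j + 1) - 1 = (int b - 1) * int M"
    unfolding M_def using power_diff_1_eq[of "int b" "j + 1"] by (simp add: lessThan_Suc_atMost)
  hence "int M dvd (int b) ^ (j + 1) - 1" by simp
  moreover have "(int b) ^ (j + 1) - 1 dvd ((int b) ^ (j + 1)) ^ t - 1"
    by (subst (2) power_diff_1_eq) simp
  ultimately have "int p ^ n dvd ((int b) ^ t) ^ (j + 1) - 1"
    using \<open>p ^ n dvd M\<close> by (metis dvd_trans of_nat_dvd_iff of_nat_power power_mult mult.commute)
  hence "int p ^ n dvd ((int b) ^ t - 1) * int (j + 1)"
    using p(1) c by (intro prime_power_dvd_power_minus_one) auto
  moreover have "(int b) ^ t > 1" using b \<open>t > 0\<close> by simp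
  ultimately have le: "int p ^ n \<le> ((int b) ^ t - 1) * int (j + 1)"
    by (intro zdvd_imp_le) auto
  \<comment> \<open>The number of digits is linear in \<open>n\<close>, because \<open>2\<^sup>j \<le> M \<le> n s\<^sup>n \<le> 2\<^sup>n (2\<^sup>s)\<^sup>n\<close>.\<close>
  have "2 ^ j \<le> b ^ j" using b by (intro power_mono) auto
  also have "\<dots> \<le> M" unfolding M_def by (rule power_le_geometric_sum)
  also have "\<dots> \<le> n * s ^ n" using eq b unfolding M_def by simp
  also have "\<dots> \<le> 2 ^ n * (2 ^ s) ^ n"
    by (intro mult_mono power_mono) (auto intro: less_imp_le)
  also have "\<dots> = 2 ^ (n + s * n)" by (simp add: power_add power_mult)
  finally have "j \<le> n + s * n" by simp
  hence j: "j + 1 \<le> (s + 2) * n" using n by simp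
  have "int (2 ^ n) \<le> int p ^ n" using prime_ge_2_nat[OF p(1)] by (simp add: power_mono)
  also have "\<dots> \<le> int (b ^ t) * int (j + 1)"
    by (rule order_trans[OF le]) (simp add: mult_right_mono)
  finally have "2 ^ n \<le> b ^ t * (j + 1)" by (metis of_nat_le_iff of_nat_mult)
  also have "\<dots> \<le> n ^ (s ^ 2) * ((s + 2) * n)"
  proof (rule mult_mono)
    have "b ^ t \<le> n ^ t" using bn by (simp add: power_mono)
    also have "\<dots> \<le> n ^ (s ^ 2)" using t n by (simp add: power_increasing)
    finally show "b ^ t \<le> n ^ (s ^ 2)" .
  qed (use j in auto)
  also have "\<dots> = (s + 2) * n ^ (s ^ 2 + 1)" by (simp add: algebra_simps)
  finally show False using dom by simp
qed

text \<open>
  The case where the base contains an \<open>n\<close>-th power. The integers \<open>s1 ^ j\<close> and \<open>s2\<close> differ by at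
  least \<open>1\<close>, and their \<open>n\<close>-th powers are comparable up to the factor \<open>2 * n ^ s\<close>. In one direction
  this needs \<open>j \<le> s\<close>, which holds as \<open>s1 ^ j < s2\<close> there.
\<close>

lemma exponential_base_impossible:
  fixes n s b j n1 n2 s1 s2 :: nat
  assumes n: "n \<ge> 1" "n = n1 * n2" and s: "s = s1 * s2" "s \<ge> 2"
    and b: "b \<ge> 2" "b = n1 * s1 ^ n" and M: "(\<Sum>i\<le>j. b ^ i) = n2 * s2 ^ n"
    and j: "j \<ge> 1" and s1: "s1 \<ge> 2"
    and dom: "\<And>x y. x < y \<Longrightarrow> y \<le> s + 1 \<Longrightarrow> 2 * n ^ s * x ^ n < y ^ n"
  shows False
proof -
  have pos: "n1 \<ge> 1" "n2 \<ge> 1" "s2 \<ge> 1" using n s by (auto intro!: Suc_leI gr0I)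
  have le: "n1 \<le> n" "n2 \<le> n" using n pos by auto
  have s2: "s2 \<le> s" using s s1 by simp
  have bj: "b ^ j = n1 ^ j * (s1 ^ j) ^ n"
    unfolding b(2) by (simp add: power_mult_distrib power_mult[symmetric] mult.commute)
  consider "s2 < s1 ^ j" | "s1 ^ j < s2" | "s1 ^ j = s2" by linarith
  thus False
  proof cases
    case 1
    have "(s2 + 1) ^ n \<le> (s1 ^ j) ^ n" using 1 by (intro power_mono) auto
    also have "\<dots> \<le> b ^ j" unfolding bj using pos by simp
    also have "\<dots> \<le> n2 * s2 ^ n" using power_le_geometric_sum M by metis
    also have "\<dots> \<le> 2 * n ^ s * s2 ^ n"
    proof (rule mult_right_mono)
      have "n2 \<le> n ^ 1" using le by simp
      also have "\<dots> \<le> n ^ s" using n(1) s(2) by (intro power_increasing) linarith+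
      finally show "n2 \<le> 2 * n ^ s" by simp
    qed simp
    also have "\<dots> < (s2 + 1) ^ n" using s2 by (intro dom) auto
    finally show False by simp
  next
    case 2
    have "j < 2 ^ j" by simp
    also have "\<dots> \<le> s1 ^ j" using s1 by (simp add: power_mono)
    finally have "j \<le> s" using 2 s2 by simp
    have "s2 ^ n \<le> n2 * s2 ^ n" using pos by simp
    also have "\<dots> < 2 * b ^ j" using geometric_sum_less[OF b(1)] M by metis
    also have "\<dots> = 2 * n1 ^ j * (s1 ^ j) ^ n" by (simp add: bj)
    also have "\<dots> \<le> 2 * n ^ s * (s1 ^ j) ^ n"
    proof -
      have "n1 ^ j \<le> n ^ j" using le by (simp add: power_mono)
      also have "\<dots> \<le> n ^ s" using n(1) \<open>j \<le> s\<close> by (simp add: power_increasing)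
      finally show ?thesis by simp
    qed
    also have "\<dots> < s2 ^ n" using 2 s2 by (intro dom) auto
    finally show False .
  next
    case 3
    \<comment> \<open>Then \<open>s1\<close> divides both of the coprime numbers \<open>b\<close> and \<open>1 + b + \<dots> + b\<^sup>j\<close>.\<close>
    have "s1 dvd b" unfolding b(2) using n(1) by (intro dvd_mult dvd_power) auto
    moreover have "s1 dvd s2" unfolding 3[symmetric] using j by (intro dvd_power) auto
    hence "s1 dvd (\<Sum>i\<le>j. b ^ i)"
      unfolding M using n(1) by (meson dvd_mult dvd_power dvd_trans less_le_trans zero_less_one)
    ultimately have "s1 = 1" using coprime_geometric_sum[of b j]
      by (metis coprime_common_divisor nat_dvd_1_iff_1)
    thus False using s1 by simp
  qed
qed

section \<open>Finiteness\<close>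

text \<open>
  The two growth conditions are those of the two shapes of the factorization; both hold for all
  large \<open>n\<close>. The first one reaches up to \<open>y = s + 1\<close> because \<open>s2 + 1\<close> can be that large.
\<close>

lemma cullen_not_repunit:
  fixes n s :: nat
  assumes s: "s \<ge> 2" and n: "n \<ge> 1"
    and dom1: "\<And>x y. x < y \<Longrightarrow> y \<le> s + 1 \<Longrightarrow> 2 * n ^ s * x ^ n < y ^ n"
    and dom2: "(s + 2) * n ^ (s ^ 2 + 1) < 2 ^ n"
  shows "\<not> repunit (cullen n s)"
proof
  assume "repunit (cullen n s)"
  then obtain b q where bq: "b \<ge> 2" "q \<ge> 3" "n * s ^ n + 1 = (\<Sum>i<q. b ^ i)"
    unfolding repunit_def cullen_def by blast
  define j where "j = q - 2"
  have j: "j \<ge> 1" "q = Suc (Suc j)" using bq unfolding j_def by auto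
  define M where "M = (\<Sum>i\<le>j. b ^ i)"
  have eq: "n * s ^ n = b * M"
    using bq(3) unfolding j(2) M_def lessThan_Suc_atMost[symmetric]
    by (subst (asm) sum.lessThan_Suc_shift) (simp add: sum_distrib_left distrib_left)
  have cop: "coprime b M" unfolding M_def by (rule coprime_geometric_sum)
  have "s ^ n dvd b * M" using eq by (metis dvd_triv_right)
  with cop s n obtain s1 s2 where s12: "s = s1 * s2" "s1 ^ n dvd b" "s2 ^ n dvd M"
    using power_dvd_coprime_mult[of s n b M] by auto
  then obtain n1 n2 where n12: "b = n1 * s1 ^ n" "M = n2 * s2 ^ n"
    by (metis dvdE mult.commute)
  have "n * s ^ n = (n1 * n2) * s ^ n"
    using eq n12 s12(1) by (simp add: power_mult_distrib mult_ac)
  hence nn: "n = n1 * n2" using s by simp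
  have "s1 \<noteq> 0" using s s12(1) by (metis mult_0 not_numeral_le_zero)
  then consider "s1 = 1" | "s1 \<ge> 2" by linarith
  thus False
  proof cases
    case 1
    hence "b \<le> n" using n12 nn n by (cases n2) auto
    thus False
      using polynomial_base_impossible[of s n b j] s n bq(1) eq s12 1 dom2 unfolding M_def by simp
  next
    case 2
    thus False
      using exponential_base_impossible[of n n1 n2 s s1 s2 b j] n nn s12(1) s bq(1) n12 j(1) dom1
      unfolding M_def by blast
  qed
qed

lemma polynomial_times_power_tendsto_0:
  fixes r :: real
  assumes "0 \<le> r" "r < 1"
  shows "(\<lambda>n. real n ^ d * r ^ n) \<longlonglongrightarrow> 0"
  using assms
proof (induction d arbitrary: r)
  case 0
  thus ?case by (simp add: LIMSEQ_power_zero)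
next
  case (Suc d)
  \<comment> \<open>Splitting \<open>r\<^sup>n = t\<^sup>n t\<^sup>n\<close> leaves a decaying factor for each of \<open>n\<close> and \<open>n\<^sup>d\<close>.\<close>
  define t where "t = sqrt r"
  have t: "0 \<le> t" "t < 1" "r = t * t" using Suc.prems by (auto simp: t_def)
  have "(\<lambda>n. (real n * t ^ n) * (real n ^ d * t ^ n)) \<longlonglongrightarrow> 0 * 0"
    using t by (intro tendsto_mult Suc.IH powser_times_n_limit_0) auto
  thus ?case by (simp add: t(3) power_mult_distrib mult_ac)
qed

lemma eventually_polynomial_exponential_less:
  fixes C d x y :: nat
  assumes "x < y"
  shows "eventually (\<lambda>n. C * n ^ d * x ^ n < y ^ n) sequentially"
proof -
  define r where "r = real x / real y"
  have r: "0 \<le> r" "r < 1" using assms by (auto simp: r_def)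
  have "(\<lambda>n. real C * (real n ^ d * r ^ n)) \<longlonglongrightarrow> real C * 0"
    by (intro tendsto_mult_left polynomial_times_power_tendsto_0 r)
  hence "eventually (\<lambda>n. real C * (real n ^ d * r ^ n) < 1) sequentially"
    by (intro order_tendstoD) auto
  thus ?thesis
  proof eventually_elim
    case (elim n)
    have "real (C * n ^ d * x ^ n) < real (y ^ n)"
      using elim assms by (simp add: r_def power_divide field_simps)
    thus ?case by (simp only: of_nat_less_iff)
  qed
qed

theorem theorem1p1:
  fixes s :: nat
  assumes "s \<ge> 2"
  shows "finite {m. (\<exists>n\<ge>1. m = cullen n s) \<and> repunit m}"
proof -
  have "eventually (\<lambda>n. \<forall>y\<in>{..s + 1}. \<forall>x\<in>{..<y}. 2 * n ^ s * x ^ n < y ^ n) sequentially"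
    by (intro eventually_ball_finite ballI) (auto intro: eventually_polynomial_exponential_less)
  moreover have "eventually (\<lambda>n. (s + 2) * n ^ (s ^ 2 + 1) * 1 ^ n < 2 ^ n) sequentially"
    by (rule eventually_polynomial_exponential_less) simp
  ultimately have "eventually (\<lambda>n. n \<ge> 1 \<longrightarrow> \<not> repunit (cullen n s)) sequentially"
  proof eventually_elim
    case (elim n)
    thus ?case using cullen_not_repunit[OF assms, of n] by auto
  qed
  then obtain N where N: "\<And>n. n \<ge> N \<Longrightarrow> n \<ge> 1 \<Longrightarrow> \<not> repunit (cullen n s)"
    unfolding eventually_sequentially by blast
  have "{m. (\<exists>n\<ge>1. m = cullen n s) \<and> repunit m} \<subseteq> (\<lambda>n. cullen n s) ` {..<N}"
  proof safe
    fix n :: nat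
    assume "n \<ge> 1" "repunit (cullen n s)"
    hence "n < N" using N by (meson not_le)
    thus "cullen n s \<in> (\<lambda>n. cullen n s) ` {..<N}" by blast
  qed
  thus ?thesis by (rule finite_subset) simp
qed

end
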